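(* Let $G$ be a regular graph and let $H$ be a regular graph on $\Delta(G)$ vertices. Then, for any choice of rotation maps, the zig-zag product, denoted here $G\,\mathrm{z}\,H$, satisfies $$\mathrm{tww}(G\,\mathrm{z}\,H)\le\max\left\{\Delta(H)^2\,(\Delta(G)-\Delta(H)+1),\ \mathrm{tww}(G)+\Delta(G)\right\}.$$
   Context: All graphs are finite and simple (no loops or multiple edges). $\Delta(G)$ is the maximum degree of $G$ (so $G$ is $\Delta(G)$-regular and $H$ is $\Delta(H)$-regular here). Twin-width. A trigraph $G$ has a vertex set $V(G)$, a set $E(G)$ of black edges and a set $R(G)$ of red edges, with $E(G)\cap R(G)=\emptyset$; a graph is a trigraph with no red edges. $N_G(v)$ is the set of vertices joined to $v$ by a black or red edge. A $d$-trigraph is a trigraph in which every vertex is incident with at most $d$ red edges. A contraction merges two distinct (not necessarily adjacent) vertices $u,v$ into a new vertex $w$: every vertex other than $u,v$ in $N_G(u)\triangle N_G(v)$ is joined to $w$ by a red edge; every $x\in N_G(u)\cap N_G(v)$ is joined to $w$ by a black edge if $ux,vx\in E(G)$ and by a red edge otherwise; all edges not incident with $u$ or $v$ are unchanged, and $u,v$ and their incident edges are removed. A $d$-sequence of an $n$-vertex graph $G$ is a sequence of $d$-trigraphs $G_n=G,G_{n-1},\dots,G_1=K_1$ with each $G_{i-1}$ obtained from $G_i$ by one contraction. The twin-width $\mathrm{tww}(G)$ is the least $d$ such that $G$ admits a $d$-sequence. Rotation maps. Let $G$ be a $d$-regular graph with vertex set $[n]$, where at each vertex the incident edges are labelled bijectively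 by $[d]$ (an edge may receive different labels at its two ends). The rotation map $\mathrm{Rot}_G:[n]\times[d]\to[n]\times[d]$ is given by $\mathrm{Rot}_G(v,i)=(w,j)$ if the $i$-th edge incident to $v$ leads to $w$ and this edge is the $j$-th edge incident to $w$. Zig-zag product. Let $G$ be $d$-regular on $[n]$ and $H$ be $\delta$-regular on $[d]$, with rotation maps $\mathrm{Rot}_G,\mathrm{Rot}_H$. The zig-zag product is the $\delta^2$-regular graph on $[n]\times[d]$ whose rotation map (with edge labels $(i,j)\in[\delta]\times[\delta]$) sends $((v,k),(i,j))$ to $((w,\ell),(j',i'))$, where $(k',i')=\mathrm{Rot}_H(k,i)$, $(w,\ell')=\mathrm{Rot}_G(v,k')$ and $(\ell,j')=\mathrm{Rot}_H(\ell',j)$. Equivalently, $(v,k)$ and $(w,\ell)$ are adjacent iff there exist $k',\ell'\in[d]$ with $kk'\in E(H)$, $\mathrm{Rot}_G(v,k')=(w,\ell')$ and $\ell'\ell\in E(H)$. *)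

theory Defs
  imports Main
begin

section \<open>Trigraphs and graphs\<close>

text \<open>Edges are two-element sets of vertices.\<close>

record 'a trigraph =
  verts :: "'a set"
  black :: "'a set set"
  red :: "'a set set"

definition trigraph :: "'a trigraph \<Rightarrow> bool" where
  "trigraph T \<longleftrightarrow> finite (verts T) \<and>
     (\<forall>e \<in> black T \<union> red T. e \<subseteq> verts T \<and> card e = 2) \<and>
     black T \<inter> red T = {}"

definition graph :: "'a trigraph \<Rightarrow> bool" where
  "graph G \<longleftrightarrow> trigraph G \<and> red G = {}"

definition nbhd :: "'a trigraph \<Rightarrow> 'a \<Rightarrow> 'a set" where
  "nbhd T v = {x. {v, x} \<in> black T \<union> red T}"

definition degree :: "'a trigraph \<Rightarrow> 'a \<Rightarrow> nat" where
  "degree T v = card (nbhd T v)"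

text \<open>The inserted \<open>0\<close> only matters for the graph without vertices.\<close>

definition max_degree :: "'a trigraph \<Rightarrow> nat" where
  "max_degree G = Max (insert 0 (degree G ` verts G))"

definition regular_graph :: "'a trigraph \<Rightarrow> bool" where
  "regular_graph G \<longleftrightarrow> graph G \<and> (\<exists>k. \<forall>v \<in> verts G. degree G v = k)"

section \<open>Twin-width\<close>

definition d_trigraph :: "nat \<Rightarrow> 'a trigraph \<Rightarrow> bool" where
  "d_trigraph d T \<longleftrightarrow> trigraph T \<and> (\<forall>v \<in> verts T. card {e \<in> red T. v \<in> e} \<le> d)"

definition contract :: "'a \<Rightarrow> 'a \<Rightarrow> 'a \<Rightarrow> 'a trigraph \<Rightarrow> 'a trigraph" where
  "contract u v w T =
    \<lparr> verts = insert w (verts T - {u, v}),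
      black = {e \<in> black T. u \<notin> e \<and> v \<notin> e} \<union>
              {{w, x} | x. x \<in> nbhd T u \<inter> nbhd T v \<and> {u, x} \<in> black T \<and> {v, x} \<in> black T},
      red = {e \<in> red T. u \<notin> e \<and> v \<notin> e} \<union>
            {{w, x} | x. x \<in> sym_diff (nbhd T u) (nbhd T v) - {u, v}} \<union>
            {{w, x} | x. x \<in> nbhd T u \<inter> nbhd T v \<and> \<not> ({u, x} \<in> black T \<and> {v, x} \<in> black T)} \<rparr>"

text \<open>The name \<open>w\<close> of the merged vertex is arbitrary as long as it differs from the vertices
  that remain. It may be one of the removed names \<open>u\<close>, \<open>v\<close>, so that a contraction is
  possible even if the vertex type has no unused element left.\<close>

definition is_contraction :: "'a trigraph \<Rightarrow> 'a trigraph \<Rightarrow> bool" where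
  "is_contraction T T' \<longleftrightarrow>
     (\<exists>u \<in> verts T. \<exists>v \<in> verts T. \<exists>w. u \<noteq> v \<and> w \<notin> verts T - {u, v} \<and> T' = contract u v w T)"

definition is_K1 :: "'a trigraph \<Rightarrow> bool" where
  "is_K1 T \<longleftrightarrow> (\<exists>x. T = \<lparr> verts = {x}, black = {}, red = {} \<rparr>)"

definition d_sequence :: "nat \<Rightarrow> 'a trigraph \<Rightarrow> (nat \<Rightarrow> 'a trigraph) \<Rightarrow> bool" where
  "d_sequence d G S \<longleftrightarrow>
     S (card (verts G)) = G \<and> is_K1 (S 1) \<and>
     (\<forall>i \<in> {1..card (verts G)}. d_trigraph d (S i)) \<and>
     (\<forall>i \<in> {2..card (verts G)}. is_contraction (S i) (S (i - 1)))"

text \<open>For the graph without vertices the conditions of \<^const>\<open>d_sequence\<close> can be met with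
  every \<open>d\<close>, so its twin-width is \<open>0\<close> by convention.\<close>

definition tww :: "'a trigraph \<Rightarrow> nat" where
  "tww G = (LEAST d. \<exists>S. d_sequence d G S)"

section \<open>Rotation maps and the zig-zag product\<close>

text \<open>\<open>lab v i\<close> is the \<open>i\<close>-th edge incident to \<open>v\<close>. For a regular graph the
  label set below has the common degree as its size. Values of \<open>rot\<close> outside
  \<open>verts G \<times> {1..max_degree G}\<close> are irrelevant.\<close>

definition rotation_map :: "'a trigraph \<Rightarrow> ('a \<times> nat \<Rightarrow> 'a \<times> nat) \<Rightarrow> bool" where
  "rotation_map G rot \<longleftrightarrow>
     (\<exists>lab. (\<forall>v \<in> verts G. bij_betw (lab v) {1..max_degree G} {e \<in> black G. v \<in> e}) \<and>
       (\<forall>v \<in> verts G. \<forall>i \<in> {1..max_degree G}. \<forall>w j. rot (v, i) = (w, j) \<longrightarrow>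
          j \<in> {1..max_degree G} \<and> lab v i = {v, w} \<and> lab w j = {v, w}))"

definition zigzag_rot ::
  "('a \<times> nat \<Rightarrow> 'a \<times> nat) \<Rightarrow> (nat \<times> nat \<Rightarrow> nat \<times> nat) \<Rightarrow>
   ('a \<times> nat) \<times> (nat \<times> nat) \<Rightarrow> ('a \<times> nat) \<times> (nat \<times> nat)" where
  "zigzag_rot rotG rotH = (\<lambda>((v, k), (i, j)).
     let (k', i') = rotH (k, i);
         (w, l') = rotG (v, k');
         (l, j') = rotH (l', j)
     in ((w, l), (j', i')))"

definition zigzag ::
  "'a trigraph \<Rightarrow> nat trigraph \<Rightarrow> ('a \<times> nat \<Rightarrow> 'a \<times> nat) \<Rightarrow> (nat \<times> nat \<Rightarrow> nat \<times> nat) \<Rightarrow>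
   ('a \<times> nat) trigraph" where
  "zigzag G H rotG rotH =
    \<lparr> verts = verts G \<times> {1..max_degree G},
      black = {{x, y} | x y. x \<in> verts G \<times> {1..max_degree G} \<and>
                 (\<exists>a \<in> {1..max_degree H} \<times> {1..max_degree H}. \<exists>b. zigzag_rot rotG rotH (x, a) = (y, b))},
      red = {} \<rparr>"

section \<open>Consistency of the definitions\<close>

lemma graph_edgeD:
  assumes "graph G" "{v, w} \<in> black G"
  shows "v \<in> verts G" "w \<in> verts G" "v \<noteq> w"
  using assms by (force simp: graph_def trigraph_def)+

lemma rotation_mapD:
  assumes "graph G" "rotation_map G rot" "v \<in> verts G" "i \<in> {1..max_degree G}" "rot (v, i) = (w, j)"
  shows "{v, w} \<in> black G" "w \<in> verts G" "v \<noteq> w" "j \<in> {1..max_degree G}" "rot (w, j) = (v, i)"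
proof -
  let ?L = "{1..max_degree G}"
  obtain lab where lab: "\<And>v. v \<in> verts G \<Longrightarrow> bij_betw (lab v) ?L {e \<in> black G. v \<in> e}"
    and rot: "\<And>v i w j. v \<in> verts G \<Longrightarrow> i \<in> ?L \<Longrightarrow> rot (v, i) = (w, j) \<Longrightarrow>
          j \<in> ?L \<and> lab v i = {v, w} \<and> lab w j = {v, w}"
    using assms(2) unfolding rotation_map_def by blast
  have r: "j \<in> ?L" "lab v i = {v, w}" "lab w j = {v, w}"
    using rot[OF assms(3-5)] by simp_all
  show e: "{v, w} \<in> black G" using bij_betw_apply[OF lab[OF assms(3)] assms(4)] r(2) by simp
  note ed = graph_edgeD[OF assms(1) e]
  show "w \<in> verts G" "v \<noteq> w" "j \<in> ?L" using ed r by blast+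
  obtain x m where xm: "rot (w, j) = (x, m)" by fastforce
  then have s: "m \<in> ?L" "lab w j = {w, x}" "lab x m = {w, x}"
    using rot[OF ed(2) r(1) xm] by simp_all
  have "x = v" using s(2) r(3) ed(3) by (auto simp: doubleton_eq_iff)
  moreover have "m = i"
  proof (rule inj_onD[OF bij_betw_imp_inj_on[OF lab[OF assms(3)]] _ s(1) assms(4)])
    show "lab v m = lab v i" using s(3) r(2) \<open>x = v\<close> by (simp add: insert_commute)
  qed
  ultimately show "rot (w, j) = (v, i)" using xm by simp
qed

lemma rotation_map_edge:
  assumes "graph G" "rotation_map G rot" "{v, w} \<in> black G"
  obtains i j where "i \<in> {1..max_degree G}" "rot (v, i) = (w, j)"
proof -
  let ?L = "{1..max_degree G}"
  obtain lab where lab: "\<And>v. v \<in> verts G \<Longrightarrow> bij_betw (lab v) ?L {e \<in> black G. v \<in> e}"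
    and rot: "\<And>v i w j. v \<in> verts G \<Longrightarrow> i \<in> ?L \<Longrightarrow> rot (v, i) = (w, j) \<Longrightarrow>
          j \<in> ?L \<and> lab v i = {v, w} \<and> lab w j = {v, w}"
    using assms(2) unfolding rotation_map_def by blast
  note ed = graph_edgeD[OF assms(1,3)]
  have "{v, w} \<in> lab v ` ?L" using lab[OF ed(1)] assms(3) by (auto simp: bij_betw_def)
  then obtain i where i: "i \<in> ?L" "lab v i = {v, w}" by force
  obtain x j where xj: "rot (v, i) = (x, j)" by fastforce
  then have "x = w" using rot[OF ed(1) i(1) xj] i(2) by (auto simp: doubleton_eq_iff)
  then show ?thesis using that i xj by blast
qed

lemma zigzag_rot_iff:
  assumes "graph G" "graph H" "rotation_map G rotG" "rotation_map H rotH"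
    and "verts H = {1..max_degree G}" "v \<in> verts G" "k \<in> {1..max_degree G}"
  shows "(\<exists>a \<in> {1..max_degree H} \<times> {1..max_degree H}. \<exists>b. zigzag_rot rotG rotH ((v, k), a) = ((w, l), b))
     \<longleftrightarrow> (\<exists>k' l'. {k, k'} \<in> black H \<and> rotG (v, k') = (w, l') \<and> {l', l} \<in> black H)" (is "?A \<longleftrightarrow> ?B")
proof
  assume ?A
  then obtain i j b where ij: "i \<in> {1..max_degree H}" "j \<in> {1..max_degree H}"
    and z: "zigzag_rot rotG rotH ((v, k), (i, j)) = ((w, l), b)" by blast
  obtain k' i' where 1: "rotH (k, i) = (k', i')" by fastforce
  obtain w' l' where 2: "rotG (v, k') = (w', l')" by fastforce
  obtain l'' j' where 3: "rotH (l', j) = (l'', j')" by fastforce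
  have [simp]: "w' = w" "l'' = l" using z by (auto simp: zigzag_rot_def 1 2 3)
  have "{k, k'} \<in> black H" "k' \<in> {1..max_degree G}"
    using rotation_mapD(1,2)[OF assms(2,4) _ ij(1) 1] assms by auto
  moreover from this have "l' \<in> {1..max_degree G}" using rotation_mapD(4)[OF assms(1,3,6) _ 2] by blast
  then have "{l', l} \<in> black H" using rotation_mapD(1)[OF assms(2,4) _ ij(2) 3] assms(5) by auto
  ultimately show ?B using 2 by auto
next
  assume ?B
  then obtain k' l' where e: "{k, k'} \<in> black H" "rotG (v, k') = (w, l')" "{l', l} \<in> black H" by blast
  obtain i i' where i: "i \<in> {1..max_degree H}" "rotH (k, i) = (k', i')"
    using rotation_map_edge[OF assms(2,4) e(1)] by blast
  obtain j j' where j: "j \<in> {1..max_degree H}" "rotH (l', j) = (l, j')"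
    using rotation_map_edge[OF assms(2,4) e(3)] by blast
  have "zigzag_rot rotG rotH ((v, k), (i, j)) = ((w, l), (j', i'))"
    by (simp add: zigzag_rot_def i j e)
  then show ?A using i j by blast
qed

lemma zigzag_adjacent_iff:
  assumes "graph G" "graph H" "rotation_map G rotG" "rotation_map H rotH"
    and "verts H = {1..max_degree G}" "v \<in> verts G" "k \<in> {1..max_degree G}"
  shows "{(v, k), (w, l)} \<in> black (zigzag G H rotG rotH) \<longleftrightarrow>
     (\<exists>k' l'. {k, k'} \<in> black H \<and> rotG (v, k') = (w, l') \<and> {l', l} \<in> black H)" (is "?A \<longleftrightarrow> ?B v k w l")
proof -
  have sym: "?B v k w l" if "?B w l v k" "w \<in> verts G" for w l
  proof -
    obtain k' l' where e: "{l, k'} \<in> black H" "rotG (w, k') = (v, l')" "{l', k} \<in> black H"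
      using \<open>?B w l v k\<close> by blast
    have "rotG (v, l') = (w, k')"
      using rotation_mapD(5)[OF assms(1,3) that(2) _ e(2)] graph_edgeD(2)[OF assms(2) e(1)] assms(5)
      by blast
    moreover have "{k, l'} \<in> black H" "{k', l} \<in> black H"
      using e(1,3) by (simp_all add: insert_commute)
    ultimately show ?thesis by blast
  qed
  show ?thesis
  proof
    assume ?A
    then obtain x y where xy: "{(v, k), (w, l)} = {x, y}" "x \<in> verts G \<times> {1..max_degree G}"
      "\<exists>a \<in> {1..max_degree H} \<times> {1..max_degree H}. \<exists>b. zigzag_rot rotG rotH (x, a) = (y, b)"
      unfolding zigzag_def trigraph.simps by blast
    obtain v1 k1 w1 l1 where [simp]: "x = (v1, k1)" "y = (w1, l1)" by fastforce
    have v1: "v1 \<in> verts G" "k1 \<in> {1..max_degree G}" using xy(2) by simp_all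
    have B: "?B v1 k1 w1 l1"
      using xy(3) zigzag_rot_iff[OF assms(1-5) v1, of w1 l1] by simp
    from xy(1) consider "v1 = v" "k1 = k" "w1 = w" "l1 = l" | "v1 = w" "k1 = l" "w1 = v" "l1 = k"
      by (auto simp: doubleton_eq_iff)
    then show "?B v k w l"
    proof cases
      case 1
      then show ?thesis using B by simp
    next
      case 2
      then show ?thesis using sym B v1(1) by simp
    qed
  next
    assume "?B v k w l"
    then have "\<exists>a \<in> {1..max_degree H} \<times> {1..max_degree H}. \<exists>b. zigzag_rot rotG rotH ((v, k), a) = ((w, l), b)"
      using zigzag_rot_iff[OF assms] by blast
    moreover have "(v, k) \<in> verts G \<times> {1..max_degree G}" using assms(6,7) by blast
    ultimately show ?A
      unfolding zigzag_def trigraph.simps mem_Collect_eq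
      by - (rule exI[of _ "(v, k)"], rule exI[of _ "(w, l)"], intro conjI refl)
  qed
qed

lemma graph_zigzag:
  assumes "graph G" "graph H" "rotation_map G rotG" "rotation_map H rotH" "verts H = {1..max_degree G}"
  shows "graph (zigzag G H rotG rotH)"
proof -
  have "e \<subseteq> verts G \<times> {1..max_degree G} \<and> card e = 2" if ez: "e \<in> black (zigzag G H rotG rotH)" for e
  proof -
    obtain x y where xy: "e = {x, y}" "x \<in> verts G \<times> {1..max_degree G}"
      using ez unfolding zigzag_def trigraph.simps by blast
    obtain v k w l where vk: "x = (v, k)" "y = (w, l)" by fastforce
    have e: "e = {(v, k), (w, l)}" "v \<in> verts G" "k \<in> {1..max_degree G}"
      using xy by (simp_all add: vk)
    obtain k' l' where *: "{k, k'} \<in> black H" "rotG (v, k') = (w, l')" "{l', l} \<in> black H"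
      using zigzag_adjacent_iff[OF assms e(2,3), THEN iffD1, OF ez[unfolded e(1)]] by blast
    have "l \<in> {1..max_degree G}" "k' \<in> {1..max_degree G}"
      using graph_edgeD(2)[OF assms(2)] * assms(5) by blast+
    moreover have "w \<in> verts G" "v \<noteq> w"
      using rotation_mapD(2,3)[OF assms(1,3) e(2) _ *(2)] calculation by blast+
    ultimately show ?thesis using e by auto
  qed
  moreover have "finite (verts G)" using assms(1) by (simp add: graph_def trigraph_def)
  moreover have "verts (zigzag G H rotG rotH) = verts G \<times> {1..max_degree G}"
    "red (zigzag G H rotG rotH) = {}" by (simp_all add: zigzag_def)
  ultimately show ?thesis by (simp add: graph_def trigraph_def)
qed

end

theory Submission
  imports Defs
begin

text \<open>A contraction sequence of a graph is a sequence of quotients by maps that merge more and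
  more fibres. In the zig-zag product first merge every cloud \<open>{v} \<times> {1..\<Delta>(G)}\<close> to a point, in any
  order: a part of the cloud of \<open>v\<close> meets at most \<open>\<Delta>(G)\<close> sets \<open>{w} \<times> N\<^sub>H(l')\<close>, so it has
  at most \<open>\<Delta>(G) \<Delta>(H) \<le> \<Delta>(H)\<^sup>2 (\<Delta>(G) - \<Delta>(H) + 1)\<close> neighbours throughout. Then follow an optimal
  sequence of \<open>G\<close>. A part of \<open>V(G)\<close> has at most \<open>\<Delta>(G)\<close> black neighbours, since each of
  them contains a neighbour of any chosen vertex of the part. So even with all edges red the
  red degree is at most \<open>tww(G) + \<Delta>(G)\<close>.\<close>

section \<open>Neighbourhoods\<close>

lemma trigraph_edgeE:
  assumes "trigraph T" "e \<in> black T \<union> red T"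
  obtains a b where "e = {a, b}" "a \<noteq> b" "a \<in> verts T" "b \<in> verts T"
proof -
  have "card e = 2" "e \<subseteq> verts T" using assms by (auto simp: trigraph_def)
  then show ?thesis using that by (auto simp: card_2_iff)
qed

lemma trigraph_edgeD:
  assumes "trigraph T" "{a, b} \<in> black T \<union> red T"
  shows "a \<in> verts T" "b \<in> verts T" "a \<noteq> b"
proof -
  have "{a, b} \<subseteq> verts T \<and> card {a, b} = 2" using assms unfolding trigraph_def by blast
  then show "a \<in> verts T" "b \<in> verts T" "a \<noteq> b" by auto
qed

lemma nbhd_subset_verts:
  assumes "trigraph T"
  shows "nbhd T a \<subseteq> verts T"
  unfolding nbhd_def using trigraph_edgeD(2)[OF assms] by blast

lemma finite_nbhd:
  assumes "trigraph T"
  shows "finite (nbhd T a)"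
  using nbhd_subset_verts[OF assms] assms by (auto simp: trigraph_def intro: finite_subset)

text \<open>The degree bounds for the constructed sequences go through this: colours are ignored and
  neighbourhoods are counted.\<close>

lemma red_degree_le_degree:
  assumes "trigraph T"
  shows "card {e \<in> red T. a \<in> e} \<le> degree T a"
proof -
  have "{e \<in> red T. a \<in> e} \<subseteq> (\<lambda>b. {a, b}) ` nbhd T a"
  proof
    fix e assume e: "e \<in> {e \<in> red T. a \<in> e}"
    then obtain x y where xy: "e = {x, y}" using trigraph_edgeE[OF assms] by blast
    then obtain b where "e = {a, b}" using e by (auto simp: insert_commute)
    then show "e \<in> (\<lambda>b. {a, b}) ` nbhd T a" using e by (auto simp: nbhd_def)
  qed
  then show ?thesis unfolding degree_def by (rule surj_card_le[OF finite_nbhd[OF assms]])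
qed

lemma degree_le_max_degree:
  assumes "trigraph T" "v \<in> verts T"
  shows "degree T v \<le> max_degree T"
  using assms by (auto simp: max_degree_def trigraph_def intro: Max_ge)

lemma max_degree_le_card_verts:
  assumes "trigraph T"
  shows "max_degree T \<le> card (verts T)"
proof -
  have "finite (verts T)" using assms by (simp add: trigraph_def)
  moreover have "degree T v \<le> card (verts T)" for v
    unfolding degree_def using calculation nbhd_subset_verts[OF assms] by (rule card_mono)
  ultimately show ?thesis by (auto simp: max_degree_def)
qed

section \<open>Quotients of a graph\<close>

definition joined :: "'a trigraph \<Rightarrow> ('a \<Rightarrow> 'b) \<Rightarrow> 'b \<Rightarrow> 'b \<Rightarrow> bool" where
  "joined G f a b \<longleftrightarrow> (\<exists>x \<in> verts G. \<exists>y \<in> verts G. f x = a \<and> f y = b \<and> {x, y} \<in> black G)"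

definition fully_joined :: "'a trigraph \<Rightarrow> ('a \<Rightarrow> 'b) \<Rightarrow> 'b \<Rightarrow> 'b \<Rightarrow> bool" where
  "fully_joined G f a b \<longleftrightarrow>
     (\<forall>x \<in> verts G. \<forall>y \<in> verts G. f x = a \<longrightarrow> f y = b \<longrightarrow> {x, y} \<in> black G)"

text \<open>The trigraph of the partition of \<open>verts G\<close> into the fibres of
  \<open>f\<close>, each fibre named by its value. \<open>fully_joined\<close> is vacuous for a
  value that is not attained, hence the explicit image conditions for black edges;
  \<open>joined\<close> implies them for red ones.\<close>

definition quotient_trigraph :: "'a trigraph \<Rightarrow> ('a \<Rightarrow> 'b) \<Rightarrow> 'b trigraph" where
  "quotient_trigraph G f =
    \<lparr> verts = f ` verts G,
      black = {{a, b} | a b. a \<in> f ` verts G \<and> b \<in> f ` verts G \<and> a \<noteq> b \<and> fully_joined G f a b},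
      red = {{a, b} | a b. a \<noteq> b \<and> joined G f a b \<and> \<not> fully_joined G f a b} \<rparr>"

lemma joined_commute: "joined G f a b \<longleftrightarrow> joined G f b a"
proof -
  have "joined G f b a" if ab: "joined G f a b" for a b
  proof -
    obtain x y where "x \<in> verts G" "y \<in> verts G" "f x = a" "f y = b" "{x, y} \<in> black G"
      using ab by (auto simp: joined_def)
    then have "y \<in> verts G" "x \<in> verts G" "f y = b" "f x = a" "{y, x} \<in> black G"
      by (simp_all add: insert_commute)
    then show ?thesis unfolding joined_def by blast
  qed
  then show ?thesis by blast
qed

lemma fully_joined_commute: "fully_joined G f a b \<longleftrightarrow> fully_joined G f b a"
proof -
  have "fully_joined G f b a" if ab: "fully_joined G f a b" for a b
    unfolding fully_joined_def
  proof (intro ballI impI)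
    fix x y assume "x \<in> verts G" "y \<in> verts G" "f x = b" "f y = a"
    then have "{y, x} \<in> black G" using ab by (simp add: fully_joined_def)
    then show "{x, y} \<in> black G" by (simp add: insert_commute)
  qed
  then show ?thesis by blast
qed

lemma joined_imp_image: "joined G f a b \<Longrightarrow> a \<in> f ` verts G \<and> b \<in> f ` verts G"
  by (auto simp: joined_def)

lemma fully_joined_imp_joined:
  "fully_joined G f a b \<Longrightarrow> a \<in> f ` verts G \<Longrightarrow> b \<in> f ` verts G \<Longrightarrow> joined G f a b"
  unfolding joined_def fully_joined_def by blast

lemma verts_quotient [simp]: "verts (quotient_trigraph G f) = f ` verts G"
  by (simp add: quotient_trigraph_def)

lemma black_quotient_iff:
  "{a, b} \<in> black (quotient_trigraph G f) \<longleftrightarrow>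
     a \<in> f ` verts G \<and> b \<in> f ` verts G \<and> a \<noteq> b \<and> fully_joined G f a b"
proof
  assume "{a, b} \<in> black (quotient_trigraph G f)"
  then obtain c d where cd: "{a, b} = {c, d}" "c \<in> f ` verts G" "d \<in> f ` verts G" "c \<noteq> d"
    "fully_joined G f c d" unfolding quotient_trigraph_def trigraph.simps by blast
  from cd(1) consider "a = c" "b = d" | "a = d" "b = c" by (auto simp: doubleton_eq_iff)
  then show "a \<in> f ` verts G \<and> b \<in> f ` verts G \<and> a \<noteq> b \<and> fully_joined G f a b"
    using cd(2-5) fully_joined_commute[of G f a b] by cases simp_all
next
  assume "a \<in> f ` verts G \<and> b \<in> f ` verts G \<and> a \<noteq> b \<and> fully_joined G f a b"
  then show "{a, b} \<in> black (quotient_trigraph G f)"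
    unfolding quotient_trigraph_def trigraph.simps by blast
qed

lemma red_quotient_iff:
  "{a, b} \<in> red (quotient_trigraph G f) \<longleftrightarrow> a \<noteq> b \<and> joined G f a b \<and> \<not> fully_joined G f a b"
proof
  assume "{a, b} \<in> red (quotient_trigraph G f)"
  then obtain c d where cd: "{a, b} = {c, d}" "c \<noteq> d" "joined G f c d" "\<not> fully_joined G f c d"
    unfolding quotient_trigraph_def trigraph.simps by blast
  from cd(1) consider "a = c" "b = d" | "a = d" "b = c" by (auto simp: doubleton_eq_iff)
  then show "a \<noteq> b \<and> joined G f a b \<and> \<not> fully_joined G f a b"
    using cd(2-4) fully_joined_commute[of G f a b] joined_commute[of G f a b] by cases simp_all
next
  assume "a \<noteq> b \<and> joined G f a b \<and> \<not> fully_joined G f a b"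
  then show "{a, b} \<in> red (quotient_trigraph G f)"
    unfolding quotient_trigraph_def trigraph.simps by blast
qed

text \<open>Both fibres of a black edge are nonempty, so complete adjacency yields at least one
  edge, and the colour disappears from the neighbourhood.\<close>

lemma nbhd_quotient: "nbhd (quotient_trigraph G f) a = {b. a \<noteq> b \<and> joined G f a b}"
  unfolding nbhd_def Un_iff black_quotient_iff red_quotient_iff
  using fully_joined_imp_joined[of G f a] joined_imp_image[of G f a] by blast

lemma trigraph_quotient:
  assumes "finite (verts G)"
  shows "trigraph (quotient_trigraph G f)"
proof -
  have "e \<subseteq> f ` verts G \<and> card e = 2" if "e \<in> black (quotient_trigraph G f) \<union> red (quotient_trigraph G f)" for e
    using that joined_imp_image[of G f] by (auto simp: quotient_trigraph_def)
  moreover have "black (quotient_trigraph G f) \<inter> red (quotient_trigraph G f) = {}"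
  proof -
    have "e \<notin> red (quotient_trigraph G f)" if e: "e \<in> black (quotient_trigraph G f)" for e
    proof -
      obtain a b where "e = {a, b}" using e by (auto simp: quotient_trigraph_def)
      then show ?thesis using e by (simp add: black_quotient_iff red_quotient_iff)
    qed
    then show ?thesis by blast
  qed
  ultimately show ?thesis using assms by (simp add: trigraph_def)
qed

lemma trigraph_eqI:
  assumes "trigraph S" "trigraph T" "verts S = verts T"
    and black: "\<And>a b. a \<noteq> b \<Longrightarrow> {a, b} \<in> black S \<longleftrightarrow> {a, b} \<in> black T"
    and red: "\<And>a b. a \<noteq> b \<Longrightarrow> {a, b} \<in> red S \<longleftrightarrow> {a, b} \<in> red T"
  shows "S = T"
proof -
  have "\<exists>a b. e = {a, b} \<and> a \<noteq> b" if "e \<in> black S \<union> red S \<union> (black T \<union> red T)" for e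
    using that trigraph_edgeE[OF assms(1)] trigraph_edgeE[OF assms(2)] by (metis Un_iff)
  then have "e \<in> black S \<longleftrightarrow> e \<in> black T" "e \<in> red S \<longleftrightarrow> e \<in> red T" for e
    using black red by (metis Un_iff)+
  then have "black S = black T" "red S = red T" by blast+
  then show ?thesis using assms(3) by simp
qed

lemma quotient_cong:
  assumes "\<And>x. x \<in> verts G \<Longrightarrow> f x = g x"
  shows "quotient_trigraph G f = quotient_trigraph G g"
proof -
  have "joined G f = joined G g" "fully_joined G f = fully_joined G g" "f ` verts G = g ` verts G"
    using assms by (auto simp: joined_def fully_joined_def fun_eq_iff)
  then show ?thesis by (simp add: quotient_trigraph_def)
qed

text \<open>The fibres are singletons, so \<open>joined\<close> and \<open>fully_joined\<close>
  coincide on distinct vertices and nothing is red. The graph itself thus starts a sequence of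
  quotients.\<close>

lemma quotient_id:
  assumes "graph G"
  shows "quotient_trigraph G (\<lambda>x. x) = G"
proof -
  have G: "trigraph G" "red G = {}" using assms by (auto simp: graph_def)
  note ed = graph_edgeD[OF assms]
  show ?thesis
  proof (rule trigraph_eqI)
    show "trigraph (quotient_trigraph G (\<lambda>x. x))" using G by (intro trigraph_quotient) (simp add: trigraph_def)
  qed (use ed G in \<open>auto simp: black_quotient_iff red_quotient_iff joined_def fully_joined_def\<close>)
qed

lemma is_K1_quotient:
  assumes "f ` verts G = {c}"
  shows "is_K1 (quotient_trigraph G f)"
proof -
  have "black (quotient_trigraph G f) = {}" "red (quotient_trigraph G f) = {}"
    using assms joined_imp_image[of G f] by (auto simp: quotient_trigraph_def)
  then have "quotient_trigraph G f = \<lparr>verts = {c}, black = {}, red = {}\<rparr>" using assms by simp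
  then show ?thesis unfolding is_K1_def by blast
qed

section \<open>Contraction as merging of two fibres\<close>

definition merge :: "'b \<Rightarrow> 'b \<Rightarrow> 'b \<Rightarrow> ('a \<Rightarrow> 'b) \<Rightarrow> 'a \<Rightarrow> 'b" where
  "merge u v w f x = (if f x \<in> {u, v} then w else f x)"

lemma image_merge:
  assumes "u \<in> f ` A"
  shows "merge u v w f ` A = insert w (f ` A - {u, v})"
  using assms by (force simp: merge_def image_iff)

text \<open>The condition on \<open>w\<close> makes its new fibre exactly the union of the old
  fibres of \<open>u\<close> and \<open>v\<close>, even when \<open>w\<close> reuses one of these
  names. A name among \<open>u\<close>, \<open>v\<close> other than \<open>w\<close> gets an empty
  fibre, so nothing is joined to it.\<close>

lemma joined_merge:
  assumes "w \<notin> f ` verts G - {u, v}"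
  shows "a \<noteq> w \<Longrightarrow> b \<noteq> w \<Longrightarrow> joined G (merge u v w f) a b \<longleftrightarrow>
      a \<notin> {u, v} \<and> b \<notin> {u, v} \<and> joined G f a b"
    and "b \<noteq> w \<Longrightarrow> joined G (merge u v w f) w b \<longleftrightarrow>
      b \<notin> {u, v} \<and> (joined G f u b \<or> joined G f v b)"
  using assms by (fastforce simp: joined_def merge_def split: if_splits)+

text \<open>An empty fibre is fully joined to everything, so unlike for \<open>joined\<close> the
  abandoned names have to be excluded by hypothesis.\<close>

lemma fully_joined_merge:
  assumes "w \<notin> f ` verts G - {u, v}" "b \<noteq> w" "b \<notin> {u, v}"
  shows "a \<noteq> w \<Longrightarrow> a \<notin> {u, v} \<Longrightarrow> fully_joined G (merge u v w f) a b \<longleftrightarrow> fully_joined G f a b"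
    and "fully_joined G (merge u v w f) w b \<longleftrightarrow> fully_joined G f u b \<and> fully_joined G f v b"
  using assms by (fastforce simp: fully_joined_def merge_def split: if_splits)+

lemma black_contract_iff:
  assumes "trigraph T" "w \<notin> verts T - {u, v}" "a \<noteq> b"
  shows "b \<noteq> w \<Longrightarrow> a \<noteq> w \<Longrightarrow> {a, b} \<in> black (contract u v w T) \<longleftrightarrow>
      a \<notin> {u, v} \<and> b \<notin> {u, v} \<and> {a, b} \<in> black T"
    and "b \<noteq> w \<Longrightarrow> a = w \<Longrightarrow> {a, b} \<in> black (contract u v w T) \<longleftrightarrow>
      {u, b} \<in> black T \<and> {v, b} \<in> black T"
proof -
  have "{a, b} \<in> black T \<Longrightarrow> a \<in> verts T" for a b using trigraph_edgeD(1)[OF assms(1)] by blast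
  \<comment> \<open>If an old edge contains \<open>w\<close>, then \<open>w\<close> is one of the
    removed names and the edge is deleted; so every edge at \<open>w\<close> after the contraction
    is new.\<close>
  then have "w \<in> {u, v}" if "{w, b} \<in> black T" for b using that assms(2) by blast
  then show "b \<noteq> w \<Longrightarrow> a \<noteq> w \<Longrightarrow> {a, b} \<in> black (contract u v w T) \<longleftrightarrow>
      a \<notin> {u, v} \<and> b \<notin> {u, v} \<and> {a, b} \<in> black T"
    and "b \<noteq> w \<Longrightarrow> a = w \<Longrightarrow> {a, b} \<in> black (contract u v w T) \<longleftrightarrow>
      {u, b} \<in> black T \<and> {v, b} \<in> black T"
    using assms(3) by (auto simp: contract_def nbhd_def doubleton_eq_iff)
qed

lemma red_contract_iff:
  assumes "trigraph T" "w \<notin> verts T - {u, v}" "a \<noteq> b"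
  shows "b \<noteq> w \<Longrightarrow> a \<noteq> w \<Longrightarrow> {a, b} \<in> red (contract u v w T) \<longleftrightarrow>
      a \<notin> {u, v} \<and> b \<notin> {u, v} \<and> {a, b} \<in> red T"
    and "b \<noteq> w \<Longrightarrow> a = w \<Longrightarrow> {a, b} \<in> red (contract u v w T) \<longleftrightarrow>
      b \<in> nbhd T u \<union> nbhd T v \<and> b \<notin> {u, v} \<and> \<not> ({u, b} \<in> black T \<and> {v, b} \<in> black T)"
proof -
  have "{a, b} \<in> red T \<Longrightarrow> a \<in> verts T" for a b using trigraph_edgeD(1)[OF assms(1)] by blast
  then have "w \<in> {u, v}" if "{w, b} \<in> red T" for b using that assms(2) by blast
  \<comment> \<open>The last set of red edges in \<open>contract\<close> does not remove
    \<open>u\<close> and \<open>v\<close> explicitly; the absence of loops keeps both out of the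
    common neighbourhood.\<close>
  moreover have "x \<notin> nbhd T x" for x unfolding nbhd_def using trigraph_edgeD(3)[OF assms(1)] by blast
  ultimately show "b \<noteq> w \<Longrightarrow> a \<noteq> w \<Longrightarrow> {a, b} \<in> red (contract u v w T) \<longleftrightarrow>
      a \<notin> {u, v} \<and> b \<notin> {u, v} \<and> {a, b} \<in> red T"
    and "b \<noteq> w \<Longrightarrow> a = w \<Longrightarrow> {a, b} \<in> red (contract u v w T) \<longleftrightarrow>
      b \<in> nbhd T u \<union> nbhd T v \<and> b \<notin> {u, v} \<and> \<not> ({u, b} \<in> black T \<and> {v, b} \<in> black T)"
    using assms(3) by (auto simp: contract_def doubleton_eq_iff nbhd_def)
qed

lemma trigraph_contract:
  assumes "trigraph T" "w \<notin> verts T - {u, v}"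
  shows "trigraph (contract u v w T)"
proof -
  let ?C = "contract u v w T"
  have nb: "x \<in> verts T" "x \<noteq> a" if "x \<in> nbhd T a" for x a
    using that trigraph_edgeD[OF assms(1)] unfolding nbhd_def by blast+
  have "e \<subseteq> verts ?C \<and> card e = 2" if "e \<in> black ?C \<union> red ?C" for e
  proof -
    from that consider "e \<in> black T \<union> red T" "u \<notin> e" "v \<notin> e"
      | x where "e = {w, x}" "x \<in> verts T - {u, v}"
      by (auto simp: contract_def dest: nb)
    then show ?thesis
    proof cases
      case 1
      then show ?thesis using assms(1) by (auto simp: trigraph_def contract_def)
    next
      case 2
      moreover from this have "x \<noteq> w" using assms(2) by blast
      ultimately show ?thesis by (auto simp: contract_def)
    qed
  qed
  note edge = this
  have "black ?C \<inter> red ?C = {}"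
  proof -
    have False if e: "e \<in> black ?C" "e \<in> red ?C" for e
    proof -
      have "card e = 2" using edge e by blast
      \<comment> \<open>The two ends are not both \<open>w\<close>; one that differs from it is
        called \<open>b\<close>, as the edge characterisations require.\<close>
      then obtain a b where ab: "e = {a, b}" "a \<noteq> b" "b \<noteq> w"
        by (metis card_2_iff insert_commute)
      have disj: "e \<notin> black T \<or> e \<notin> red T" using assms(1) by (auto simp: trigraph_def)
      show False
        using e disj black_contract_iff[OF assms ab(2)] red_contract_iff[OF assms ab(2)] ab
        by (cases "a = w") auto
    qed
    then show ?thesis by blast
  qed
  moreover have "finite (verts ?C)" using assms(1) by (simp add: trigraph_def contract_def)
  ultimately show ?thesis using edge unfolding trigraph_def by blast
qed

text \<open>The vertex pairs between the merged fibre and another fibre are those of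
  \<open>u\<close> together with those of \<open>v\<close>. Hence all of them are edges iff this
  holds for both fibres, and some is an edge iff this holds for one of them: the colouring rule of a
  contraction.\<close>

lemma contract_quotient:
  assumes "finite (verts G)" "u \<in> f ` verts G" "v \<in> f ` verts G"
    and w: "w \<notin> f ` verts G - {u, v}"
  shows "contract u v w (quotient_trigraph G f) = quotient_trigraph G (merge u v w f)"
proof (rule trigraph_eqI)
  let ?T = "quotient_trigraph G f" and ?M = "merge u v w f"
  have T: "trigraph ?T" "w \<notin> verts ?T - {u, v}"
    using assms trigraph_quotient by auto
  show "trigraph (contract u v w ?T)" using T by (rule trigraph_contract)
  show "trigraph (quotient_trigraph G ?M)" using assms(1) by (rule trigraph_quotient)
  note im = image_merge[OF assms(2), of v w]
  show "verts (contract u v w ?T) = verts (quotient_trigraph G ?M)" using im by (simp add: contract_def)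
  have B: "{a, b} \<in> black (contract u v w ?T) \<longleftrightarrow> {a, b} \<in> black (quotient_trigraph G ?M)"
    and R: "{a, b} \<in> red (contract u v w ?T) \<longleftrightarrow> {a, b} \<in> red (quotient_trigraph G ?M)"
    if ab: "a \<noteq> b" "b \<noteq> w" for a b
  proof -
    show "{a, b} \<in> black (contract u v w ?T) \<longleftrightarrow> {a, b} \<in> black (quotient_trigraph G ?M)"
    proof (cases "a = w")
      case True
      then show ?thesis
        using black_contract_iff(2)[OF T ab True] fully_joined_merge(2)[OF w ab(2)] assms(2,3) ab
        by (auto simp: black_quotient_iff im)
    next
      case False
      then show ?thesis
        using black_contract_iff(1)[OF T ab False] fully_joined_merge(1)[OF w ab(2)] ab
        by (auto simp: black_quotient_iff im)
    qed
    show "{a, b} \<in> red (contract u v w ?T) \<longleftrightarrow> {a, b} \<in> red (quotient_trigraph G ?M)"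
    proof (cases "a = w")
      case True
      have "b \<in> f ` verts G" if "joined G f x b" for x using joined_imp_image[OF that] by blast
      then show ?thesis
        using red_contract_iff(2)[OF T ab True] fully_joined_merge(2)[OF w ab(2)]
          joined_merge(2)[OF w ab(2)] True assms(2,3) ab
        by (auto simp: red_quotient_iff black_quotient_iff nbhd_quotient)
    next
      case False
      then show ?thesis
        using red_contract_iff(1)[OF T ab False] fully_joined_merge(1)[OF w ab(2)]
          joined_merge(1)[OF w False ab(2)] ab
        by (auto simp: red_quotient_iff)
    qed
  qed
  \<comment> \<open>\<open>B\<close> and \<open>R\<close> assume that the second end is not
    \<open>w\<close>; if it is, the ends are swapped.\<close>
  show "{a, b} \<in> black (contract u v w ?T) \<longleftrightarrow> {a, b} \<in> black (quotient_trigraph G ?M)" if "a \<noteq> b" for a b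
    using B[of a b] B[of b a] that by (cases "b = w") (auto simp: insert_commute)
  show "{a, b} \<in> red (contract u v w ?T) \<longleftrightarrow> {a, b} \<in> red (quotient_trigraph G ?M)" if "a \<noteq> b" for a b
    using R[of a b] R[of b a] that by (cases "b = w") (auto simp: insert_commute)
qed

lemma is_contraction_quotient:
  assumes "finite (verts G)" "u \<in> f ` verts G" "v \<in> f ` verts G" "u \<noteq> v"
    and "w \<notin> f ` verts G - {u, v}"
  shows "is_contraction (quotient_trigraph G f) (quotient_trigraph G (merge u v w f))"
  unfolding is_contraction_def verts_quotient
  using contract_quotient[OF assms(1-3,5)] assms(2-5) by metis

section \<open>Contraction sequences\<close>

text \<open>An index-free form of contraction sequences, suited to rule induction; the length is
  forced, since every contraction removes one vertex. A single vertex without edges calls for no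
  degree condition.\<close>

inductive reducible :: "nat \<Rightarrow> 'a trigraph \<Rightarrow> bool" for d where
  K1: "is_K1 T \<Longrightarrow> reducible d T"
| step: "d_trigraph d T \<Longrightarrow> is_contraction T T' \<Longrightarrow> reducible d T' \<Longrightarrow> reducible d T"

lemma reducible_mono:
  assumes "reducible d T" "d \<le> d'"
  shows "reducible d' T"
  using assms(1)
proof induction
  case (step T T')
  have "d_trigraph d' T"
    using step.hyps(1) assms(2) unfolding d_trigraph_def by (meson le_trans)
  then show ?case using step.hyps(2) step.IH by (rule reducible.step)
qed (rule reducible.K1)

text \<open>The sequence is read upwards from its last member \<open>S 1\<close>. The graph without
  vertices is excluded because it satisfies \<open>d_sequence\<close> without being
  reducible.\<close>

lemma d_sequence_imp_reducible:
  assumes "d_sequence d G S" "verts G \<noteq> {}" "finite (verts G)"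
  shows "reducible d G"
proof -
  have "reducible d (S (Suc i))" if "Suc i \<le> card (verts G)" for i
    using that
  proof (induction i)
    case 0
    then show ?case using assms(1) by (simp add: d_sequence_def reducible.K1)
  next
    case (Suc i)
    then have i: "Suc (Suc i) \<in> {2..card (verts G)}" "Suc (Suc i) \<in> {1..card (verts G)}" by auto
    then have "is_contraction (S (Suc (Suc i))) (S (Suc (Suc i) - 1))" "d_trigraph d (S (Suc (Suc i)))"
      using assms(1) unfolding d_sequence_def by blast+
    then show ?case using Suc reducible.step by fastforce
  qed
  from this[of "card (verts G) - 1"] show ?thesis
    using assms by (simp add: d_sequence_def card_gt_0_iff Suc_leI)
qed

lemma reducible_imp_d_sequence:
  assumes "reducible d T"
  shows "card (verts T) \<ge> 1 \<and> (\<exists>S. d_sequence d T S)"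
  using assms
proof (induction rule: reducible.induct)
  case (K1 T)
  then have "d_sequence d T (\<lambda>_. T)"
    by (auto simp: d_sequence_def is_K1_def d_trigraph_def trigraph_def)
  then show ?case using K1 by (auto simp: is_K1_def)
next
  case (step T T')
  obtain u v w where uvw: "u \<in> verts T" "v \<in> verts T" "u \<noteq> v" "w \<notin> verts T - {u, v}"
    "T' = contract u v w T" using step.hyps(2) unfolding is_contraction_def by blast
  have fin: "finite (verts T)" using step.hyps(1) by (simp add: d_trigraph_def trigraph_def)
  have "card {u, v} \<le> card (verts T)" using uvw fin by (intro card_mono) auto
  then have "card (verts T) \<ge> 2" using uvw(3) by simp
  moreover have "card (verts T') = Suc (card (verts T) - 2)"
    using uvw fin by (simp add: contract_def card_Diff_subset)
  ultimately have n: "card (verts T) = Suc (card (verts T'))" by simp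
  obtain S where S: "d_sequence d T' S" using step.IH by blast
  \<comment> \<open>The new index is at least 2, so the one-vertex trigraph at index 1 is not
    overwritten.\<close>
  have "d_sequence d T (S(card (verts T) := T))"
    using S n step.IH step.hyps unfolding d_sequence_def
    by (auto simp: le_Suc_eq)
  then show ?case using n by auto
qed

lemma tww_le_if_reducible:
  assumes "reducible d T"
  shows "tww T \<le> d"
  unfolding tww_def using reducible_imp_d_sequence[OF assms] by (auto intro: Least_le)

text \<open>Every fibre of the retraction is contracted onto its fixed point.\<close>

lemma reducible_if_reducible_retract:
  assumes G: "graph G"
    and r: "\<And>x. x \<in> verts G \<Longrightarrow> r x \<in> verts G" "\<And>x. x \<in> verts G \<Longrightarrow> r (r x) = r x"
    and bound: "\<And>g. (\<And>x. x \<in> verts G \<Longrightarrow> r (g x) = r x) \<Longrightarrow> d_trigraph d (quotient_trigraph G g)"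
    and red: "reducible d (quotient_trigraph G r)"
  shows "reducible d G"
proof -
  have fin: "finite (verts G)" using G by (simp add: graph_def trigraph_def)
  \<comment> \<open>The first condition keeps every part inside a fibre of \<open>r\<close>, so that
    \<open>bound\<close> applies. The second keeps \<open>r x\<close> as the name of its own part,
    so that it is always available as a target.\<close>
  define compatible where "compatible g \<longleftrightarrow>
    (\<forall>x \<in> verts G. r (g x) = r x \<and> g (r x) = r x)" for g
  have "reducible d (quotient_trigraph G g)" if "compatible g" for g
    using that
  proof (induction "card (g ` verts G)" arbitrary: g rule: less_induct)
    case less
    have g: "r (g x) = r x" "g (r x) = r x" if "x \<in> verts G" for x
      using less.prems that by (auto simp: compatible_def)
    show ?case
    proof (cases "\<forall>x \<in> verts G. g x = r x")
      case True
      then have "quotient_trigraph G g = quotient_trigraph G r" by (intro quotient_cong) simp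
      then show ?thesis using red by simp
    next
      case False
      then obtain x where x: "x \<in> verts G" "g x \<noteq> r x" by blast
      \<comment> \<open>Both values are sent to \<open>r x\<close> by \<open>r\<close>, so the
        merged map stays compatible. Keeping the name \<open>r x\<close> makes just the value
        \<open>g x\<close> disappear.\<close>
      let ?m = "merge (r x) (g x) (r x) g"
      have u: "r x \<in> g ` verts G" using g(2)[OF x(1)] r(1)[OF x(1)] by (metis imageI)
      have v: "g x \<in> g ` verts G" using x by blast
      have "?m ` verts G = g ` verts G - {g x}" using image_merge[OF u, of "g x" "r x"] u x(2) by auto
      then have "card (?m ` verts G) < card (g ` verts G)"
        using v fin by (metis card_Diff1_less finite_imageI)
      moreover have "compatible ?m"
        unfolding compatible_def
      proof (intro ballI conjI)
        fix y assume y: "y \<in> verts G"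
        show "r (?m y) = r y" using g(1)[OF y] g(1)[OF x(1)] r(2)[OF x(1)] by (auto simp: merge_def)
        show "?m (r y) = r y" using g(2)[OF y] g(1)[OF x(1)] r(2)[OF y] by (auto simp: merge_def)
      qed
      ultimately have "reducible d (quotient_trigraph G ?m)" using less.hyps by blast
      moreover have "is_contraction (quotient_trigraph G g) (quotient_trigraph G ?m)"
        using fin u v x(2) by (intro is_contraction_quotient) auto
      ultimately show ?thesis using bound g(1) reducible.step by blast
    qed
  qed
  moreover have "compatible (\<lambda>x. x)" using r by (simp add: compatible_def)
  ultimately show ?thesis using quotient_id[OF G] by metis
qed

text \<open>The \<open>LEAST\<close> in \<open>tww\<close> is attained because some sequence exists:
  the graph is retracted onto one vertex, and no quotient has a degree above the number of
  vertices.\<close>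

lemma reducible_tww:
  assumes "graph G" "verts G \<noteq> {}"
  shows "reducible (tww G) G"
proof -
  have fin: "finite (verts G)" using assms(1) by (simp add: graph_def trigraph_def)
  obtain c where c: "c \<in> verts G" using assms(2) by blast
  have "reducible (card (verts G)) G"
  proof (rule reducible_if_reducible_retract[OF assms(1), of "\<lambda>_. c"])
    show "reducible (card (verts G)) (quotient_trigraph G (\<lambda>_. c))"
      using c by (intro reducible.K1 is_K1_quotient[of _ _ c]) auto
    fix g :: "'a \<Rightarrow> 'a"
    have T: "trigraph (quotient_trigraph G g)" using fin by (rule trigraph_quotient)
    have "degree (quotient_trigraph G g) a \<le> card (verts G)" for a
    proof -
      have "degree (quotient_trigraph G g) a \<le> card (g ` verts G)"
        unfolding degree_def using nbhd_subset_verts[OF T] fin by (intro card_mono) auto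
      then show ?thesis using card_image_le[OF fin, of g] by linarith
    qed
    then show "d_trigraph (card (verts G)) (quotient_trigraph G g)"
      unfolding d_trigraph_def using T red_degree_le_degree[OF T] le_trans by blast
  qed (use c in auto)
  then have "\<exists>d S. d_sequence d G S" using reducible_imp_d_sequence by blast
  then have "\<exists>S. d_sequence (tww G) G S" unfolding tww_def by (rule LeastI_ex)
  then show ?thesis using d_sequence_imp_reducible assms(2) fin by blast
qed

section \<open>Lifting contraction sequences along a homomorphism\<close>

lemma degree_quotient_le:
  assumes "graph G" "d_trigraph d (quotient_trigraph G f)" "a \<in> f ` verts G"
  shows "degree (quotient_trigraph G f) a \<le> d + max_degree G"
proof -
  have G: "trigraph G" "finite (verts G)" using assms(1) by (auto simp: graph_def trigraph_def)
  obtain x where x: "x \<in> verts G" "f x = a" using assms(3) by blast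
  let ?T = "quotient_trigraph G f"
  have T: "trigraph ?T" using G(2) by (rule trigraph_quotient)
  let ?R = "{b. {a, b} \<in> red ?T}" and ?B = "{b. {a, b} \<in> black ?T}"
  have "?B \<subseteq> f ` nbhd G x"
    using x by (auto simp: black_quotient_iff fully_joined_def nbhd_def)
  then have "card ?B \<le> degree G x"
    unfolding degree_def by (rule surj_card_le[OF finite_nbhd[OF G(1)]])
  then have B: "card ?B \<le> max_degree G" using degree_le_max_degree[OF G(1) x(1)] by linarith
  \<comment> \<open>\<open>d_trigraph\<close> counts red edges while \<open>degree\<close> counts
    neighbours; this injection translates between them.\<close>
  have "inj_on (\<lambda>b. {a, b}) ?R" by (auto simp: inj_on_def doubleton_eq_iff)
  moreover have "{e \<in> red ?T. a \<in> e} \<subseteq> Pow (verts ?T)" using T unfolding trigraph_def by blast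
  then have "finite {e \<in> red ?T. a \<in> e}"
    by (rule finite_subset) (use G(2) in simp)
  ultimately have "card ?R \<le> card {e \<in> red ?T. a \<in> e}" by (intro card_inj_on_le) auto
  then have R: "card ?R \<le> d" using assms(2,3) by (force simp: d_trigraph_def)
  have "nbhd ?T a = ?R \<union> ?B" by (auto simp: nbhd_def)
  then have "degree ?T a \<le> card ?R + card ?B" unfolding degree_def using card_Un_le by metis
  then show ?thesis using R B by linarith
qed

text \<open>Edges of \<open>Z\<close> lie over edges of \<open>G\<close>, so a part has no more
  neighbours in the quotient of \<open>Z\<close> than in that of \<open>G\<close>. A complete pair
  of fibres in \<open>G\<close> may be incomplete in \<open>Z\<close>, so black neighbours are
  counted too and cost \<open>max_degree G\<close>. The map \<open>f\<close> is arbitrary because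
  each contraction replaces it by a merged map.\<close>

lemma reducible_quotient_lift:
  fixes G :: "'a trigraph" and Z :: "'b trigraph" and \<pi> :: "'b \<Rightarrow> 'a" and \<iota> :: "'c \<Rightarrow> 'd"
  assumes red: "reducible d (quotient_trigraph G f)"
    and G: "graph G" and Z: "finite (verts Z)"
    and \<pi>: "\<pi> ` verts Z = verts G" and \<iota>: "inj \<iota>"
    and hom: "\<And>x y. {x, y} \<in> black Z \<Longrightarrow> {\<pi> x, \<pi> y} \<in> black G"
  shows "reducible (d + max_degree G) (quotient_trigraph Z (\<lambda>x. \<iota> (f (\<pi> x))))"
  using red
proof (induction "quotient_trigraph G f" arbitrary: f rule: reducible.induct)
  case K1
  then obtain c where "f ` verts G = {c}"
    by (metis is_K1_def verts_quotient trigraph.select_convs(1))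
  then have "(\<lambda>x. \<iota> (f (\<pi> x))) ` verts Z = {\<iota> c}" using \<pi> by (metis image_image image_empty image_insert)
  then show ?case by (intro reducible.K1 is_K1_quotient)
next
  case (step T')
  have G': "finite (verts G)" using G by (auto simp: graph_def trigraph_def)
  let ?F = "\<lambda>x. \<iota> (f (\<pi> x))"
  have im: "?F ` verts Z = \<iota> ` f ` verts G" using \<pi> by (metis image_image)
  have T: "trigraph (quotient_trigraph Z ?F)" using Z by (rule trigraph_quotient)
  obtain u v w where uvw: "u \<in> f ` verts G" "v \<in> f ` verts G" "u \<noteq> v" "w \<notin> f ` verts G - {u, v}"
    "T' = contract u v w (quotient_trigraph G f)" using step.hyps(2) unfolding is_contraction_def by auto
  have "T' = quotient_trigraph G (merge u v w f)" using contract_quotient[OF G' uvw(1,2,4)] uvw(5) by simp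
  then have IH: "reducible (d + max_degree G) (quotient_trigraph Z (\<lambda>x. \<iota> (merge u v w f (\<pi> x))))"
    by (rule step.hyps(4))
  \<comment> \<open>Injectivity keeps distinct names distinct, so merging commutes with the renaming
    \<iota>.\<close>
  have m: "merge (\<iota> u) (\<iota> v) (\<iota> w) ?F = (\<lambda>x. \<iota> (merge u v w f (\<pi> x)))"
    using \<iota> by (auto simp: merge_def inj_eq)
  have "\<iota> u \<noteq> \<iota> v" "\<iota> w \<notin> ?F ` verts Z - {\<iota> u, \<iota> v}" "\<iota> u \<in> ?F ` verts Z" "\<iota> v \<in> ?F ` verts Z"
    unfolding im using uvw \<iota> by (auto simp: inj_eq)
  then have con: "is_contraction (quotient_trigraph Z ?F)
      (quotient_trigraph Z (\<lambda>x. \<iota> (merge u v w f (\<pi> x))))"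
    using is_contraction_quotient[OF Z, of "\<iota> u" ?F "\<iota> v" "\<iota> w"] m by simp
  have "card {e \<in> red (quotient_trigraph Z ?F). a \<in> e} \<le> d + max_degree G" if a: "a \<in> ?F ` verts Z" for a
  proof -
    obtain c where c: "a = \<iota> c" "c \<in> f ` verts G" using a im by blast
    have "nbhd (quotient_trigraph Z ?F) a \<subseteq> \<iota> ` nbhd (quotient_trigraph G f) c"
    proof
      fix b assume "b \<in> nbhd (quotient_trigraph Z ?F) a"
      then obtain x y where xy: "?F x = a" "?F y = b" "{x, y} \<in> black Z" "a \<noteq> b"
        "x \<in> verts Z" "y \<in> verts Z"
        by (auto simp: nbhd_quotient joined_def)
      have "f (\<pi> x) = c" using xy(1) c(1) \<iota> by (simp add: inj_eq)
      moreover have "f (\<pi> x) \<noteq> f (\<pi> y)" using xy by auto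
      moreover have "\<pi> x \<in> verts G" "\<pi> y \<in> verts G" using \<pi> xy(5,6) by auto
      ultimately have "f (\<pi> y) \<in> nbhd (quotient_trigraph G f) c"
        using hom[OF xy(3)] by (auto simp: nbhd_quotient joined_def)
      then show "b \<in> \<iota> ` nbhd (quotient_trigraph G f) c" using xy(2) by blast
    qed
    then have "degree (quotient_trigraph Z ?F) a \<le> degree (quotient_trigraph G f) c"
      unfolding degree_def by (rule surj_card_le[OF finite_nbhd[OF trigraph_quotient[OF G']]])
    then show ?thesis
      using red_degree_le_degree[OF T, of a] degree_quotient_le[OF G step.hyps(1) c(2)] by linarith
  qed
  then have "d_trigraph (d + max_degree G) (quotient_trigraph Z ?F)" using T by (simp add: d_trigraph_def)
  then show ?case using con IH by (rule reducible.step)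
qed

section \<open>The zig-zag product\<close>

lemma degree_quotient_zigzag_le:
  fixes g :: "'a \<times> nat \<Rightarrow> 'a \<times> nat"
  assumes "graph G" "graph H" "rotation_map G rotG" "rotation_map H rotH"
    and VH: "verts H = {1..max_degree G}"
    and g: "\<And>x. x \<in> verts G \<times> {1..max_degree G} \<Longrightarrow> fst (g x) = fst x"
    and a: "a \<in> g ` (verts G \<times> {1..max_degree G})"
  shows "degree (quotient_trigraph (zigzag G H rotG rotH) g) a \<le> max_degree G * max_degree H"
proof -
  let ?Z = "zigzag G H rotG rotH" and ?D = "{1..max_degree G}"
  have H: "trigraph H" using assms(2) by (simp add: graph_def)
  have V: "verts ?Z = verts G \<times> ?D" by (simp add: zigzag_def)
  \<comment> \<open>Since \<open>g\<close> preserves first coordinates, the whole part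
    \<open>a\<close> lies in the cloud of this \<open>v\<close>.\<close>
  define v where "v = fst a"
  have v: "v \<in> verts G" using a g by (auto simp: v_def)
  \<comment> \<open>The names of the parts reached through the \<open>k'\<close>-th edge at
    \<open>v\<close>. They do not depend on the second coordinate of the starting vertex, so the
    same \<open>max_degree G\<close> sets serve all vertices of the part.\<close>
  define N where "N k' = g ` (case rotG (v, k') of (w, l') \<Rightarrow> {w} \<times> nbhd H l')" for k'
  have "nbhd (quotient_trigraph ?Z g) a \<subseteq> (\<Union>k' \<in> ?D. N k')"
  proof
    fix b assume "b \<in> nbhd (quotient_trigraph ?Z g) a"
    then obtain x y where xy: "x \<in> verts G \<times> ?D" "y \<in> verts G \<times> ?D" "g x = a" "g y = b"
      "{x, y} \<in> black ?Z" by (auto simp: nbhd_quotient joined_def V)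
    obtain k w l where kwl: "x = (v, k)" "y = (w, l)" "k \<in> ?D"
      using xy(1,3) g[OF xy(1)] by (cases x; cases y) (auto simp: v_def)
    obtain k' l' where e: "{k, k'} \<in> black H" "rotG (v, k') = (w, l')" "{l', l} \<in> black H"
      using xy(5) zigzag_adjacent_iff[OF assms(1-4) VH v kwl(3)] kwl by auto
    have "k' \<in> ?D" using graph_edgeD(2)[OF assms(2) e(1)] VH by simp
    moreover have "b \<in> N k'" using e(2,3) kwl xy(4) by (auto simp: N_def nbhd_def)
    ultimately show "b \<in> (\<Union>k' \<in> ?D. N k')" by blast
  qed
  moreover have N: "finite (N k') \<and> card (N k') \<le> max_degree H" if k': "k' \<in> ?D" for k'
  proof -
    obtain w l' where r: "rotG (v, k') = (w, l')" by fastforce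
    have "l' \<in> verts H" using rotation_mapD(4)[OF assms(1,3) v k' r] VH by simp
    then have "card ({w} \<times> nbhd H l') \<le> max_degree H"
      using degree_le_max_degree[OF H] by (simp add: degree_def card_cartesian_product)
    moreover have fin: "finite ({w} \<times> nbhd H l')" using finite_nbhd[OF H] by simp
    ultimately show ?thesis
      using card_image_le[OF fin, of g] by (auto simp: N_def r)
  qed
  ultimately have "degree (quotient_trigraph ?Z g) a \<le> card (\<Union>k' \<in> ?D. N k')"
    unfolding degree_def by (intro card_mono) auto
  also have "\<dots> \<le> (\<Sum>k' \<in> ?D. card (N k'))" by (rule card_UN_le) simp
  also have "\<dots> \<le> max_degree G * max_degree H"
    using sum_bounded_above[of ?D "\<lambda>k'. card (N k')" "max_degree H"] N by simp
  finally show ?thesis .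
qed

text \<open>The right side minus the left side is \<open>m (m - 1) (n - m)\<close>.\<close>

lemma mult_le_square_mult:
  assumes "m \<le> n"
  shows "int (n * m) \<le> (int m)\<^sup>2 * (int n - int m + 1)"
proof (cases m)
  case (Suc k)
  have "0 \<le> int m * (int k * (int n - int m))" using assms by simp
  also have "\<dots> = (int m)\<^sup>2 * (int n - int m + 1) - int (n * m)"
    by (simp add: Suc algebra_simps power2_eq_square)
  finally show ?thesis by simp
qed simp

theorem theorem4p5:
  fixes G :: "'a trigraph" and H :: "nat trigraph"
    and rotG :: "'a \<times> nat \<Rightarrow> 'a \<times> nat" and rotH :: "nat \<times> nat \<Rightarrow> nat \<times> nat"
  assumes "regular_graph G"
    and "regular_graph H"
    and "verts H = {1..max_degree G}"
    and "rotation_map G rotG"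
    and "rotation_map H rotH"
  shows "int (tww (zigzag G H rotG rotH)) \<le>
    max ((int (max_degree H))\<^sup>2 * (int (max_degree G) - int (max_degree H) + 1))
        (int (tww G) + int (max_degree G))"
proof -
  let ?Z = "zigzag G H rotG rotH" and ?D = "{1..max_degree G}"
  have G: "graph G" and H: "graph H" using assms by (auto simp: regular_graph_def)
  have Z: "graph ?Z" using graph_zigzag[OF G H assms(4,5,3)] .
  have fin: "finite (verts ?Z)" using Z by (simp add: graph_def trigraph_def)
  have V: "verts ?Z = verts G \<times> ?D" by (simp add: zigzag_def)
  have "max_degree H \<le> card (verts H)" using H by (intro max_degree_le_card_verts) (simp add: graph_def)
  then have DH: "max_degree H \<le> max_degree G" using assms(3) by simp
  show ?thesis
  proof (cases "verts ?Z = {}")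
    case True
    \<comment> \<open>Index 0 has to carry the empty product and index 1 a one-vertex trigraph; the
      other conditions range over empty sets.\<close>
    then have "d_sequence 0 ?Z (\<lambda>i. if i = 0 then ?Z else \<lparr>verts = {undefined}, black = {}, red = {}\<rparr>)"
      by (auto simp: d_sequence_def is_K1_def)
    then have "tww ?Z \<le> 0" unfolding tww_def by (intro Least_le) blast
    then show ?thesis by simp
  next
    case False
    then have D: "1 \<in> ?D" and VG: "verts G \<noteq> {}" by (auto simp: V)
    define d where "d = max (max_degree G * max_degree H) (tww G + max_degree G)"
    have "reducible d ?Z"
    \<comment> \<open>Each cloud is contracted onto its vertex with label 1, which exists because
      the product has vertices.\<close>
    proof (rule reducible_if_reducible_retract[OF Z, of "\<lambda>x. (fst x, 1)"])
      have "fst ` verts ?Z = verts G" using D by (force simp: V)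
      \<comment> \<open>The middle step of a zig-zag walk is an edge of \<open>G\<close>, so the
        first projection is a homomorphism.\<close>
      moreover have "{fst x, fst y} \<in> black G" if e: "{x, y} \<in> black ?Z" for x y
      proof -
        obtain v k w l where vk: "x = (v, k)" "y = (w, l)" by fastforce
        have v: "v \<in> verts G" "k \<in> ?D" using graph_edgeD(1)[OF Z e] vk V by auto
        obtain k' l' where e': "{k, k'} \<in> black H" "rotG (v, k') = (w, l')"
          using e zigzag_adjacent_iff[OF G H assms(4,5,3) v] vk by auto
        have "k' \<in> ?D" using graph_edgeD(2)[OF H e'(1)] assms(3) by simp
        then show ?thesis using rotation_mapD(1)[OF G assms(4) v(1) _ e'(2)] vk by simp
      qed
      ultimately have "reducible (tww G + max_degree G) (quotient_trigraph ?Z (\<lambda>x. (fst x, 1)))"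
        \<comment> \<open>With \<open>f\<close> the identity the quotient of \<open>G\<close> is
          \<open>G\<close>, so its optimal sequence is lifted. The injection turns vertices of
          \<open>G\<close> into pairs, as the retraction demands.\<close>
        using reducible_quotient_lift[where f = "\<lambda>x. x" and \<pi> = fst and \<iota> = "\<lambda>v. (v, 1)",
            OF _ G fin] reducible_tww[OF G VG] quotient_id[OF G]
        by (simp add: inj_on_def)
      then show "reducible d (quotient_trigraph ?Z (\<lambda>x. (fst x, 1)))"
        by (rule reducible_mono) (simp add: d_def)
    next
      fix g :: "'a \<times> nat \<Rightarrow> 'a \<times> nat"
      assume "\<And>x. x \<in> verts ?Z \<Longrightarrow> (fst (g x), 1::nat) = (fst x, 1)"
      \<comment> \<open>Equal retractions mean equal first coordinates, so every intermediate part
        stays inside one cloud.\<close>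
      then have g: "fst (g x) = fst x" if "x \<in> verts G \<times> ?D" for x using that V by auto
      have T: "trigraph (quotient_trigraph ?Z g)" using fin by (rule trigraph_quotient)
      have "card {e \<in> red (quotient_trigraph ?Z g). a \<in> e} \<le> d" if "a \<in> g ` verts ?Z" for a
        using red_degree_le_degree[OF T, of a] that V
          degree_quotient_zigzag_le[OF G H assms(4,5,3) g, of a] by (simp add: d_def)
      then show "d_trigraph d (quotient_trigraph ?Z g)" using T by (simp add: d_trigraph_def)
    qed (use D in \<open>auto simp: V\<close>)
    then have "tww ?Z \<le> d" by (rule tww_le_if_reducible)
    then have "int (tww ?Z) \<le> max (int (max_degree G * max_degree H)) (int (tww G) + int (max_degree G))"
      unfolding d_def by linarith
    then show ?thesis using mult_le_square_mult[OF DH] by linarith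
  qed
qed

end
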